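(* Let $X\subseteq\mathbb{R}^2$ be the union of three rays $\overrightarrow{oa}$, $\overrightarrow{ob}$ and $\overrightarrow{oc}$ with common origin $o$ (the origin included) such that $$\angle aob=\angle boc=\angle coa=\frac{2\pi}{3}.$$ Then $X$, with the metric induced from the Euclidean plane $\mathbb{R}^2$, is minimal $\mathfrak{F}_3$-universal.
   Context: $\mathfrak{F}_3$ is the class of metric spaces $Z$ with $|Z|\le 3$. For metric spaces, $Z\hookrightarrow Y$ means that there is an isometric embedding (distance-preserving map) of $Z$ in $Y$. A metric space $Y$ is universal for a class $\mathfrak{M}$ of metric spaces ($\mathfrak{M}$-universal, written $\mathfrak{M}\hookrightarrow Y$) if $Z\hookrightarrow Y$ for every $Z\in\mathfrak{M}$; it is minimal $\mathfrak{M}$-universal if moreover for every subspace $Y_0\subseteq Y$ (with the induced metric), $\mathfrak{M}\hookrightarrow Y_0$ implies $Y_0=Y$. *)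

theory Defs
  imports "HOL-Analysis.Analysis"
begin

definition isometric_embedding :: "'a metric \<Rightarrow> 'b metric \<Rightarrow> ('a \<Rightarrow> 'b) \<Rightarrow> bool" where
  "isometric_embedding Z Y f \<longleftrightarrow>
     f \<in> mspace Z \<rightarrow> mspace Y \<and>
     (\<forall>x\<in>mspace Z. \<forall>y\<in>mspace Z. mdist Y (f x) (f y) = mdist Z x y)"

definition embeds :: "'a metric \<Rightarrow> 'b metric \<Rightarrow> bool" where
  "embeds Z Y \<longleftrightarrow> (\<exists>f. isometric_embedding Z Y f)"

definition universal_for :: "'a metric set \<Rightarrow> 'b metric \<Rightarrow> bool" where
  "universal_for \<MM> Y \<longleftrightarrow> (\<forall>Z\<in>\<MM>. embeds Z Y)"

definition minimal_universal_for :: "'a metric set \<Rightarrow> 'b metric \<Rightarrow> bool" where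
  "minimal_universal_for \<MM> Y \<longleftrightarrow>
     universal_for \<MM> Y \<and>
     (\<forall>S\<subseteq>mspace Y. universal_for \<MM> (submetric Y S) \<longrightarrow> submetric Y S = Y)"

(* HOL has no type of all metric spaces, so this is the class of those whose points come from
   the type 'a. As soon as 'a has three distinct elements, it contains an isometric copy of
   every metric space with at most three points, over any type; see universal_for_F3_transfer. *)
definition F3 :: "'a metric set" where
  "F3 = {Z. finite (mspace Z) \<and> card (mspace Z) \<le> 3}"

definition ray :: "'a::real_vector \<Rightarrow> 'a \<Rightarrow> 'a set" where
  "ray p a = {p + t *\<^sub>R (a - p) | t. 0 \<le> t}"

(* The angle a p b, with vertex p, in the interval [0, pi]; only meaningful for a, b \<noteq> p. *)
definition angle :: "'a::real_inner \<Rightarrow> 'a \<Rightarrow> 'a \<Rightarrow> real" where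
  "angle a p b = arccos (((a - p) \<bullet> (b - p)) / (norm (a - p) * norm (b - p)))"

lemma F3_isometric_copy:
  fixes Z :: "'b metric"
  assumes three: "\<exists>x y z :: 'a. distinct [x, y, z]" and Z: "Z \<in> F3"
  shows "\<exists>W :: 'a metric. W \<in> F3 \<and>
           (\<exists>g. isometric_embedding Z W g \<and> g ` mspace Z = mspace W)"
proof -
  obtain x y z :: 'a where "distinct [x, y, z]"
    using three by blast
  then have c3: "card {x, y, z} = 3"
    by simp
  have fin: "finite (mspace Z)" and card: "card (mspace Z) \<le> 3"
    using Z by (auto simp: F3_def)
  obtain g where g: "inj_on g (mspace Z)" "g ` mspace Z \<subseteq> {x, y, z}"
    using card_le_inj [OF fin, of "{x, y, z}"] card c3 by auto
  define h where "h = inv_into (mspace Z) g"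
  have hg: "h (g u) = u" if "u \<in> mspace Z" for u
    using that g by (simp add: h_def)
  define d where "d = (\<lambda>u v. mdist Z (h u) (h v))"
  have M: "Metric_space (g ` mspace Z) d"
  proof
    show "0 \<le> d u v" for u v
      by (simp add: d_def)
    show "d u v = d v u" for u v
      unfolding d_def by (rule mdist_commute)
    show "d u v = 0 \<longleftrightarrow> u = v" if "u \<in> g ` mspace Z" "v \<in> g ` mspace Z" for u v
      using that by (auto simp: d_def hg)
    show "d u w \<le> d u v + d v w"
      if "u \<in> g ` mspace Z" "v \<in> g ` mspace Z" "w \<in> g ` mspace Z" for u v w
      using that by (auto simp: d_def hg intro: mdist_triangle)
  qed
  define W where "W = metric (g ` mspace Z, d)"
  have W: "mspace W = g ` mspace Z" "mdist W = d"
    using M by (simp_all add: W_def Metric_space.mspace_metric Metric_space.mdist_metric)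
  have "W \<in> F3"
    using fin card card_image [OF g(1)] by (simp add: F3_def W)
  moreover have "isometric_embedding Z W g"
    by (simp add: isometric_embedding_def W d_def hg)
  ultimately show ?thesis
    using W by blast
qed

lemma universal_for_F3_transfer:
  assumes "\<exists>x y z :: 'a. distinct [x, y, z]"
    and "universal_for (F3 :: 'a metric set) Y"
  shows "universal_for (F3 :: 'b metric set) Y"
  unfolding universal_for_def
proof
  fix Z :: "'b metric"
  assume "Z \<in> F3"
  then obtain W :: "'a metric" and g where "W \<in> F3" and g: "isometric_embedding Z W g"
    using F3_isometric_copy [OF assms(1)] by metis
  then obtain f where f: "isometric_embedding W Y f"
    using assms(2) unfolding universal_for_def embeds_def by blast
  have "isometric_embedding Z Y (f \<circ> g)"
    using f g by (simp add: isometric_embedding_def Pi_iff)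
  then show "embeds Z Y"
    unfolding embeds_def by blast
qed

end

theory Submission
  imports Defs
begin

text \<open>
  Write \<open>e\<^sub>1, e\<^sub>2, e\<^sub>3\<close> for the unit vectors along the rays, so that
  \<open>e\<^sub>i \<bullet> e\<^sub>j = -1/2\<close> for \<open>i \<noteq> j\<close>. By the law of cosines, points at heights \<open>s\<close> and \<open>t\<close> above
  the centre \<open>p\<close> are at squared distance \<open>s\<^sup>2 + s t + t\<^sup>2\<close> if they lie on different rays, and
  \<open>(s - t)\<^sup>2\<close> if they lie on the same one. Both parts of the proof are computations
  with these two quadratic forms.

  Universality. Let \<open>x, y \<le> z \<le> x + y\<close> be the side lengths of a triangle. If the angle
  opposite to \<open>z\<close> is at most \<open>2\<pi>/3\<close>, that is \<open>z\<^sup>2 \<le> x\<^sup>2 + x y + y\<^sup>2\<close>, then the triangle has a Fermat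
  point that sees each pair of vertices under the angle \<open>2\<pi>/3\<close>, and moving this point to \<open>p\<close>
  puts one vertex on each ray (\<open>fermat_point_heights\<close>). If the angle is larger, one side \<open>y\<close>
  adjacent to it is put on one ray, with the obtuse vertex nearer to \<open>p\<close>, and slid along this ray
  until the remaining vertex can be placed on a second ray (\<open>obtuse_heights\<close>). Nonempty spaces with
  fewer than three points are degenerate triangles.

  Minimality. Every point of the tripod is forced by some three-point space. An equilateral
  triangle with side \<open>\<surd>3 r\<close> fits in the tripod in only one position, namely with one vertex at height
  \<open>r\<close> on each ray (\<open>tripod_equilateral_rigid\<close>), so each point other than \<open>p\<close> is needed. A triangle
  with sides \<open>1, 1, \<surd>3\<close> has an angle of exactly \<open>2\<pi>/3\<close>, and fits only with the vertex of this
  angle at \<open>p\<close> (\<open>tripod_apex_at_centre\<close>).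
\<close>

section \<open>Heights realising a triangle\<close>

text \<open>
  The heights are the distances \<open>u, v, w\<close> of the Fermat point from the vertices. Subtracting the
  required equations in pairs gives \<open>(u - w) S = z\<^sup>2 - y\<^sup>2\<close> and \<open>(v - w) S = z\<^sup>2 - x\<^sup>2\<close> for the sum
  \<open>S = u + v + w\<close>, so that \<open>u, v, w\<close> are determined by \<open>S\<close>, and \<open>S\<^sup>2\<close> turns out to be the larger root
  of a quadratic equation, \<open>S\<^sup>2 = (x\<^sup>2 + y\<^sup>2 + z\<^sup>2) / 2 + 2 \<surd>3 \<Delta>\<close> with \<open>\<Delta>\<close> the area of the triangle.
  The bound on \<open>z\<close> is what makes the smallest height \<open>w\<close> nonnegative.
\<close>

lemma fermat_point_heights:
  fixes x y z :: real
  assumes "0 \<le> x" "0 \<le> y" "x \<le> z" "y \<le> z" "z \<le> x + y" "z\<^sup>2 \<le> x\<^sup>2 + x * y + y\<^sup>2"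
  obtains u v w where "0 \<le> u" "0 \<le> v" "0 \<le> w"
    "u\<^sup>2 + u * v + v\<^sup>2 = z\<^sup>2" "u\<^sup>2 + u * w + w\<^sup>2 = x\<^sup>2" "w\<^sup>2 + w * v + v\<^sup>2 = y\<^sup>2"
proof (cases "z = 0")
  case True
  then have "x = 0" "y = 0" using assms by auto
  with True show thesis using that [of 0 0 0] by simp
next
  case False
  define X Y Z where "X = x\<^sup>2" and "Y = y\<^sup>2" and "Z = z\<^sup>2"
  have pos: "0 \<le> X" "0 \<le> Y" "0 < Z"
    using False by (auto simp: X_def Y_def Z_def)
  have le: "X \<le> Z" "Y \<le> Z"
    using assms by (auto simp: X_def Y_def Z_def intro: power_mono)
  have "z\<^sup>2 \<le> (x + y)\<^sup>2" using assms by (intro power_mono) auto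
  moreover have "(x - y)\<^sup>2 \<le> z\<^sup>2" using assms by (intro power2_le_iff_abs_le[THEN iffD2]) auto
  ultimately have "\<bar>Z - X - Y\<bar> \<le> 2 * (x * y)"
    by (simp add: X_def Y_def Z_def power2_eq_square abs_le_iff algebra_simps)
  then have "(Z - X - Y)\<^sup>2 \<le> (2 * (x * y))\<^sup>2"
    by (meson abs_ge_zero abs_le_square_iff abs_of_nonneg order_trans power2_le_iff_abs_le)
  also have "\<dots> = 4 * X * Y" by (simp add: X_def Y_def power_mult_distrib)
  finally have area: "0 \<le> 4 * X * Y - (Z - X - Y)\<^sup>2" by simp
  \<comment> \<open>\<open>D = 4 \<surd>3 \<Delta>\<close>, by Heron's formula\<close>
  define D where "D = sqrt (3 * (4 * X * Y - (Z - X - Y)\<^sup>2))"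
  have D2: "D\<^sup>2 = 3 * (4 * X * Y - (Z - X - Y)\<^sup>2)" and "0 \<le> D"
    using area by (simp_all add: D_def)
  define q where "q = (X + Y + Z + D) / 2"
  have quad: "q\<^sup>2 - (X + Y + Z) * q + (X\<^sup>2 + Y\<^sup>2 + Z\<^sup>2 - X * Y - Y * Z - Z * X) = 0"
    using D2 unfolding q_def by (simp add: power2_eq_square field_simps)
  have "0 < q" using pos \<open>0 \<le> D\<close> by (simp add: q_def)
  define S where "S = sqrt q"
  have S: "0 < S" "S\<^sup>2 = q" using \<open>0 < q\<close> by (simp_all add: S_def)
  define h where "h m = (S + m / S) / 3" for m
  have h_mono: "h m \<le> h n" if "m \<le> n" for m n
    using that S by (simp add: h_def divide_right_mono)
  have form: "(h m)\<^sup>2 + h m * h n + (h n)\<^sup>2 = t"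
    if "3 * q\<^sup>2 + 3 * (m + n) * q + (m\<^sup>2 + m * n + n\<^sup>2) = 9 * t * q" for m n t
  proof -
    have hS: "h k * (3 * S) = q + k" for k
      using S by (simp add: h_def field_simps power2_eq_square)
    have "((h m)\<^sup>2 + h m * h n + (h n)\<^sup>2) * (9 * S\<^sup>2)
        = (h m * (3 * S))\<^sup>2 + (h m * (3 * S)) * (h n * (3 * S)) + (h n * (3 * S))\<^sup>2"
      by (simp add: power2_eq_square algebra_simps)
    also have "\<dots> = (q + m)\<^sup>2 + (q + m) * (q + n) + (q + n)\<^sup>2" by (simp only: hS)
    also have "\<dots> = t * (9 * S\<^sup>2)"
      using that S by (simp add: power2_eq_square algebra_simps)
    finally show ?thesis using S \<open>0 < q\<close> by simp
  qed
  have "3 * (Z - X - Y) \<le> D"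
  proof (cases "Z - X - Y \<le> 0")
    case True
    then show ?thesis using \<open>0 \<le> D\<close> by argo
  next
    case False
    have "(Z - X - Y)\<^sup>2 \<le> (x * y)\<^sup>2"
      using assms False by (intro power_mono) (auto simp: X_def Y_def Z_def)
    also have "\<dots> = X * Y" by (simp add: X_def Y_def power_mult_distrib)
    finally have "(3 * (Z - X - Y))\<^sup>2 \<le> D\<^sup>2"
      unfolding D2 power_mult_distrib by simp
    then show ?thesis using \<open>0 \<le> D\<close> by (rule power2_le_imp_le)
  qed
  then have "0 \<le> q + (X + Y - 2 * Z)" by (simp add: q_def field_simps)
  then have w: "0 \<le> h (X + Y - 2 * Z)"
    using S by (simp add: h_def field_simps power2_eq_square)
  show thesis
  proof (rule that [of "h (X + Z - 2 * Y)" "h (Y + Z - 2 * X)" "h (X + Y - 2 * Z)"])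
    show "0 \<le> h (X + Z - 2 * Y)" "0 \<le> h (Y + Z - 2 * X)"
      using order_trans [OF w h_mono] le by simp_all
    show "0 \<le> h (X + Y - 2 * Z)" by (fact w)
    show "(h (X + Z - 2 * Y))\<^sup>2 + h (X + Z - 2 * Y) * h (Y + Z - 2 * X) + (h (Y + Z - 2 * X))\<^sup>2 = z\<^sup>2"
      unfolding Z_def [symmetric] by (rule form) (use quad in algebra)
    show "(h (X + Z - 2 * Y))\<^sup>2 + h (X + Z - 2 * Y) * h (X + Y - 2 * Z) + (h (X + Y - 2 * Z))\<^sup>2 = x\<^sup>2"
      unfolding X_def [symmetric] by (rule form) (use quad in algebra)
    show "(h (X + Y - 2 * Z))\<^sup>2 + h (X + Y - 2 * Z) * h (Y + Z - 2 * X) + (h (Y + Z - 2 * X))\<^sup>2 = y\<^sup>2"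
      unfolding Y_def [symmetric] by (rule form) (use quad in algebra)
  qed
qed

text \<open>
  Here \<open>w\<close> and \<open>w + y\<close> are heights on one ray and \<open>u\<close> is a height on another. The difference of the two
  required equations is \<open>u + 2 w = k\<close> with \<open>k = (z\<^sup>2 - x\<^sup>2 - y\<^sup>2) / y\<close>, and then the first one reads
  \<open>3 u\<^sup>2 + k\<^sup>2 = 4 x\<^sup>2\<close>. The triangle inequality gives \<open>k \<le> 2 x\<close>, so \<open>u\<close> exists, and the lower bound on
  \<open>z\<^sup>2\<close> gives \<open>x \<le> k\<close>, so \<open>u \<le> k\<close> and \<open>w\<close> is nonnegative.
\<close>

lemma obtuse_heights:
  fixes x y z :: real
  assumes "0 \<le> x" "0 < y" "0 \<le> z" "z \<le> x + y" "x\<^sup>2 + x * y + y\<^sup>2 \<le> z\<^sup>2"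
  obtains u w where "0 \<le> u" "0 \<le> w"
    "u\<^sup>2 + u * w + w\<^sup>2 = x\<^sup>2" "u\<^sup>2 + u * (w + y) + (w + y)\<^sup>2 = z\<^sup>2"
proof -
  define k where "k = (z\<^sup>2 - x\<^sup>2 - y\<^sup>2) / y"
  have ky: "k * y = z\<^sup>2 - x\<^sup>2 - y\<^sup>2" using assms by (simp add: k_def)
  have "z\<^sup>2 \<le> (x + y)\<^sup>2" using assms by (intro power_mono) auto
  then have "k \<le> 2 * x"
    using assms by (simp add: k_def pos_divide_le_eq power2_eq_square algebra_simps)
  moreover have "x \<le> k"
    using assms by (simp add: k_def pos_le_divide_eq algebra_simps)
  ultimately have k: "k\<^sup>2 \<le> 4 * x\<^sup>2" "x\<^sup>2 \<le> k\<^sup>2" "0 \<le> k"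
    using assms power_mono [of k "2 * x" 2] power_mono [of x k 2]
    by (auto simp: power_mult_distrib)
  define u where "u = sqrt ((4 * x\<^sup>2 - k\<^sup>2) / 3)"
  have u2: "3 * u\<^sup>2 = 4 * x\<^sup>2 - k\<^sup>2" and "0 \<le> u"
    using k by (simp_all add: u_def)
  have "u\<^sup>2 \<le> k\<^sup>2" using u2 k by linarith
  then have "u \<le> k" using k by (metis power2_le_imp_le)
  have 1: "u\<^sup>2 + u * ((k - u) / 2) + ((k - u) / 2)\<^sup>2 = x\<^sup>2"
    using u2 by (simp add: power2_eq_square field_simps)
  show thesis
  proof (rule that [of u "(k - u) / 2"])
    have "u\<^sup>2 + u * ((k - u) / 2 + y) + ((k - u) / 2 + y)\<^sup>2
        = (u\<^sup>2 + u * ((k - u) / 2) + ((k - u) / 2)\<^sup>2) + k * y + y\<^sup>2"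
      by (simp add: power2_eq_square field_simps)
    also have "\<dots> = z\<^sup>2" unfolding 1 ky by simp
    finally show "u\<^sup>2 + u * ((k - u) / 2 + y) + ((k - u) / 2 + y)\<^sup>2 = z\<^sup>2" .
  qed (use \<open>0 \<le> u\<close> \<open>u \<le> k\<close> 1 in auto)
qed

section \<open>Metric geometry of the tripod\<close>

text \<open>
  The directions of the rays, as an unordered set so that no ray is distinguished; the inner
  product \<open>-1/2\<close> is \<open>cos (2\<pi>/3)\<close>.
\<close>

definition tripod_frame :: "'a::real_inner set \<Rightarrow> bool" where
  "tripod_frame U \<longleftrightarrow>
     card U = 3 \<and> (\<forall>e\<in>U. \<forall>f\<in>U. e \<bullet> f = (if e = f then 1 else - 1 / 2))"

definition tripod :: "'a::real_inner \<Rightarrow> 'a set \<Rightarrow> 'a set" where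
  "tripod p U = {p + t *\<^sub>R e | t e. 0 \<le> t \<and> e \<in> U}"

lemma tripodI: "0 \<le> t \<Longrightarrow> e \<in> U \<Longrightarrow> p + t *\<^sub>R e \<in> tripod p U"
  by (auto simp: tripod_def)

lemma tripodE:
  assumes "P \<in> tripod p U"
  obtains t e where "P = p + t *\<^sub>R e" "0 \<le> t" "e \<in> U"
  using assms by (auto simp: tripod_def)

lemma tripod_dist_sq:
  assumes "tripod_frame U" "e \<in> U" "f \<in> U"
  shows "(dist (p + s *\<^sub>R e) (p + t *\<^sub>R f))\<^sup>2
       = (if e = f then (s - t)\<^sup>2 else s\<^sup>2 + s * t + t\<^sup>2)"
proof -
  have *: "e \<bullet> e = 1" "f \<bullet> f = 1" "e \<bullet> f = (if e = f then 1 else - 1 / 2)"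
    using assms by (auto simp: tripod_frame_def)
  have "(dist (p + s *\<^sub>R e) (p + t *\<^sub>R f))\<^sup>2 = (s *\<^sub>R e - t *\<^sub>R f) \<bullet> (s *\<^sub>R e - t *\<^sub>R f)"
    by (simp add: dist_norm power2_norm_eq_inner)
  also have "\<dots> = s\<^sup>2 * (e \<bullet> e) - 2 * s * t * (e \<bullet> f) + t\<^sup>2 * (f \<bullet> f)"
    by (simp add: inner_diff_left inner_diff_right inner_commute [of f e] power2_eq_square
        algebra_simps)
  also have "\<dots> = (if e = f then (s - t)\<^sup>2 else s\<^sup>2 + s * t + t\<^sup>2)"
    unfolding * by (simp add: power2_eq_square algebra_simps)
  finally show ?thesis .
qed

lemma tripod_dist_eqI:
  assumes "tripod_frame U" "e \<in> U" "f \<in> U" "0 \<le> d"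
    and "(if e = f then (s - t)\<^sup>2 else s\<^sup>2 + s * t + t\<^sup>2) = d\<^sup>2"
  shows "dist (p + s *\<^sub>R e) (p + t *\<^sub>R f) = d"
  by (rule power2_eq_imp_eq) (use assms tripod_dist_sq [OF assms(1-3)] in simp_all)

lemma tripod_frame_obtain:
  assumes "tripod_frame U"
  obtains e f g where "U = {e, f, g}" "e \<noteq> f" "f \<noteq> g" "e \<noteq> g"
proof -
  have "card U = 3" using assms by (simp add: tripod_frame_def)
  then show thesis using that by (auto simp: card_3_iff)
qed

section \<open>Universality\<close>

text \<open>
  The longest side is \<open>PR\<close>, so \<open>Q\<close> is the vertex with the largest angle, and this angle decides
  whether the vertices go to three rays or to two.
\<close>

lemma tripod_realises_triangle_sorted:
  assumes U: "tripod_frame U"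
    and xyz: "0 \<le> x" "0 \<le> y" "x \<le> z" "y \<le> z" "z \<le> x + y"
  obtains P Q R where "P \<in> tripod p U" "Q \<in> tripod p U" "R \<in> tripod p U"
    "dist P Q = x" "dist Q R = y" "dist P R = z"
proof -
  obtain e f g where efg: "U = {e, f, g}" "e \<noteq> f" "f \<noteq> g" "e \<noteq> g"
    using tripod_frame_obtain [OF U] by blast
  show thesis
  proof (cases "z\<^sup>2 \<le> x\<^sup>2 + x * y + y\<^sup>2")
    case True
    then obtain u v w where h: "0 \<le> u" "0 \<le> v" "0 \<le> w"
      "u\<^sup>2 + u * v + v\<^sup>2 = z\<^sup>2" "u\<^sup>2 + u * w + w\<^sup>2 = x\<^sup>2" "w\<^sup>2 + w * v + v\<^sup>2 = y\<^sup>2"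
      using fermat_point_heights [OF xyz] by blast
    show thesis
      by (rule that [of "p + u *\<^sub>R e" "p + w *\<^sub>R f" "p + v *\<^sub>R g"])
        (use efg h xyz in \<open>auto intro!: tripodI tripod_dist_eqI [OF U] simp del: dist_add_cancel\<close>)
  next
    case False
    have "y \<noteq> 0"
    proof
      assume "y = 0"
      with xyz have "z = x" by simp
      with False \<open>y = 0\<close> show False by simp
    qed
    then obtain u w where h: "0 \<le> u" "0 \<le> w"
      "u\<^sup>2 + u * w + w\<^sup>2 = x\<^sup>2" "u\<^sup>2 + u * (w + y) + (w + y)\<^sup>2 = z\<^sup>2"
      using obtuse_heights [of x y z] xyz False by auto
    show thesis
      by (rule that [of "p + u *\<^sub>R e" "p + w *\<^sub>R f" "p + (w + y) *\<^sub>R f"])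
        (use efg h xyz in \<open>auto intro!: tripodI tripod_dist_eqI [OF U] simp del: dist_add_cancel\<close>)
  qed
qed

lemma tripod_realises_triangle:
  assumes U: "tripod_frame U"
    and "0 \<le> x" "0 \<le> y" "0 \<le> z" "x \<le> y + z" "y \<le> x + z" "z \<le> x + y"
  shows "\<exists>P\<in>tripod p U. \<exists>Q\<in>tripod p U. \<exists>R\<in>tripod p U.
           dist P Q = x \<and> dist Q R = y \<and> dist P R = z"
proof -
  consider "x \<le> z" "y \<le> z" | "x \<le> y" "z \<le> y" | "y \<le> x" "z \<le> x" by linarith
  then show ?thesis
  proof cases
    case 1
    then show ?thesis
      using tripod_realises_triangle_sorted [OF U, of x y z p] assms by metis
  next
    case 2
    then obtain Q P R where "Q \<in> tripod p U" "P \<in> tripod p U" "R \<in> tripod p U"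
      "dist Q P = x" "dist P R = z" "dist Q R = y"
      using tripod_realises_triangle_sorted [OF U, of x z y p] assms by auto
    then show ?thesis by (metis dist_commute)
  next
    case 3
    then obtain P R Q where "P \<in> tripod p U" "R \<in> tripod p U" "Q \<in> tripod p U"
      "dist P R = z" "dist R Q = y" "dist P Q = x"
      using tripod_realises_triangle_sorted [OF U, of z y x p] assms by auto
    then show ?thesis by (metis dist_commute)
  qed
qed

lemma set_card_le_3_eq:
  assumes "finite A" "card A \<le> 3" "A \<noteq> {}"
  obtains x y z where "A = {x, y, z}"
proof -
  have "0 < card A" using assms by (simp add: card_gt_0_iff)
  then have "card A = 1 \<or> card A = 2 \<or> card A = 3" using assms by linarith
  then show thesis
    using that by (metis card_1_singletonE card_2_iff card_3_iff insert_absorb2)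
qed

lemma tripod_universal:
  assumes U: "tripod_frame U"
  shows "universal_for (F3 :: 'z metric set) (submetric euclidean_metric (tripod p U))"
  unfolding universal_for_def
proof
  fix Z :: "'z metric"
  assume Z: "Z \<in> F3"
  show "embeds Z (submetric euclidean_metric (tripod p U))"
  proof (cases "mspace Z = {}")
    case True
    then show ?thesis by (auto simp: embeds_def isometric_embedding_def)
  next
    case False
    then obtain a b c where abc: "mspace Z = {a, b, c}"
      using Z set_card_le_3_eq [of "mspace Z"] by (auto simp: F3_def)
    let ?d = "mdist Z"
    have tri: "?d a b \<le> ?d b c + ?d a c" "?d b c \<le> ?d a b + ?d a c" "?d a c \<le> ?d a b + ?d b c"
      using mdist_triangle [of a Z c b] mdist_triangle [of b Z a c] mdist_triangle [of a Z b c]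
      by (simp_all add: abc mdist_commute add.commute)
    obtain P Q R where PQR: "P \<in> tripod p U" "Q \<in> tripod p U" "R \<in> tripod p U"
      and d: "dist P Q = ?d a b" "dist Q R = ?d b c" "dist P R = ?d a c"
      using tripod_realises_triangle [OF U _ _ _ tri, of p] by auto
    \<comment> \<open>If some of \<open>a, b, c\<close> coincide, then so do their images, because these are at distance 0.\<close>
    define f where "f v = (if v = a then P else if v = b then Q else R)" for v
    have "a = b \<Longrightarrow> P = Q" "b = c \<Longrightarrow> Q = R" "a = c \<Longrightarrow> P = R"
      using d abc mdist_zero [of _ Z] by (metis dist_eq_0_iff insertI1 insertI2)+
    then have f: "f a = P" "f b = Q" "f c = R" by (auto simp: f_def)
    have "isometric_embedding Z (submetric euclidean_metric (tripod p U)) f"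
      using PQR d by (auto simp: isometric_embedding_def abc f dist_commute mdist_commute)
    then show ?thesis by (auto simp: embeds_def)
  qed
qed

section \<open>Rigid triangles\<close>

text \<open>
  If two vertices of an equilateral triangle were on one ray, the third could not lie on this ray
  too. From a third vertex on another ray, the distance to a point of this ray is strictly
  increasing in its height, so the two vertices would be equal.
\<close>

lemma equilateral_heights_distinct_rays:
  assumes U: "tripod_frame U" "e \<in> U" "f \<in> U" "g \<in> U"
    and pos: "0 \<le> s" "0 \<le> t" "0 \<le> u" "0 < d"
    and "dist (p + s *\<^sub>R e) (p + t *\<^sub>R f) = d"
    and "dist (p + t *\<^sub>R f) (p + u *\<^sub>R g) = d"
    and "dist (p + s *\<^sub>R e) (p + u *\<^sub>R g) = d"
  shows "e \<noteq> f"
proof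
  assume "e = f"
  then have st: "(s - t)\<^sup>2 = d\<^sup>2"
    using tripod_dist_sq [OF U(1,2,3), of p s t] assms by simp
  have tu: "(if f = g then (t - u)\<^sup>2 else t\<^sup>2 + t * u + u\<^sup>2) = d\<^sup>2"
    using tripod_dist_sq [OF U(1,3,4), of p t u] assms by simp
  have su: "(if f = g then (s - u)\<^sup>2 else s\<^sup>2 + s * u + u\<^sup>2) = d\<^sup>2"
    using tripod_dist_sq [OF U(1,2,4), of p s u] assms \<open>e = f\<close> by simp
  have "s \<noteq> t" using st pos by auto
  show False
  proof (cases "f = g")
    case True
    then show False
      using st tu su pos by (auto simp: power2_eq_iff)
  next
    case False
    then have "(s - t) * (s + t + u) = 0"
      using tu su by (simp add: power2_eq_square algebra_simps)
    then show False using \<open>s \<noteq> t\<close> pos by auto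
  qed
qed

lemma tripod_equilateral_rigid:
  assumes U: "tripod_frame U"
    and PQR: "P \<in> tripod p U" "Q \<in> tripod p U" "R \<in> tripod p U"
    and r: "0 < r"
    and d: "dist P Q = sqrt 3 * r" "dist Q R = sqrt 3 * r" "dist P R = sqrt 3 * r"
  shows "(\<lambda>e. p + r *\<^sub>R e) ` U = {P, Q, R}"
proof -
  obtain s e where P: "P = p + s *\<^sub>R e" "0 \<le> s" "e \<in> U" using PQR tripodE by metis
  obtain t f where Q: "Q = p + t *\<^sub>R f" "0 \<le> t" "f \<in> U" using PQR tripodE by metis
  obtain u g where R: "R = p + u *\<^sub>R g" "0 \<le> u" "g \<in> U" using PQR tripodE by metis
  have pos: "0 < sqrt 3 * r" using r by simp
  note distinct = equilateral_heights_distinct_rays [OF U _ _ _ _ _ _ pos]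
  have "e \<noteq> f" by (rule distinct [of e f g s t u p]) (use P Q R d in simp_all)
  moreover have "f \<noteq> g"
    by (rule distinct [of f g e t u s p]) (use P Q R d in \<open>simp_all add: dist_commute\<close>)
  moreover have "e \<noteq> g"
    by (rule distinct [of e g f s u t p]) (use P Q R d in \<open>simp_all add: dist_commute\<close>)
  moreover have "card U = 3" "finite U"
    using U by (auto simp: tripod_frame_def intro: card_ge_0_finite)
  ultimately have Ueq: "U = {e, f, g}"
    using card_subset_eq [of U "{e, f, g}"] P Q R by simp
  have eqs: "s\<^sup>2 + s * t + t\<^sup>2 = 3 * r\<^sup>2" "t\<^sup>2 + t * u + u\<^sup>2 = 3 * r\<^sup>2" "s\<^sup>2 + s * u + u\<^sup>2 = 3 * r\<^sup>2"
    using tripod_dist_sq [OF U P(3) Q(3), of p s t] tripod_dist_sq [OF U Q(3) R(3), of p t u]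
      tripod_dist_sq [OF U P(3) R(3), of p s u] d \<open>e \<noteq> f\<close> \<open>f \<noteq> g\<close> \<open>e \<noteq> g\<close>
    by (simp_all add: P(1) Q(1) R(1) power_mult_distrib)
  have "s + t + u \<noteq> 0"
  proof
    assume "s + t + u = 0"
    then have "s = 0" "t = 0" using P Q R by linarith+
    then show False using eqs r by simp
  qed
  moreover have "(s - u) * (s + t + u) = 0" "(s - t) * (s + t + u) = 0"
    using eqs by (simp_all add: power2_eq_square algebra_simps)
  ultimately have "u = s" "t = s" by auto
  then have "s\<^sup>2 = r\<^sup>2" using eqs by (simp add: power2_eq_square)
  then have "s = r" using P r by (simp add: power2_eq_iff)
  then show ?thesis
    using \<open>u = s\<close> \<open>t = s\<close> by (auto simp: Ueq P(1) Q(1) R(1))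
qed

text \<open>
  On three different rays the heights \<open>u, v, w\<close> would satisfy \<open>u = v = 1\<close> and hence \<open>w = 0\<close>. Three points
  on one ray are collinear, which the distances exclude. With two points on one ray and the third
  on another, the angle at the inner one of the two is at least \<open>2\<pi>/3\<close>, with equality only if it is
  at the centre; the angles of the triangle are \<open>2\<pi>/3, \<pi>/6, \<pi>/6\<close>, so the inner one is \<open>Q\<close> and is
  at the centre.
\<close>

lemma tripod_apex_at_centre:
  assumes U: "tripod_frame U"
    and PQR: "P \<in> tripod p U" "Q \<in> tripod p U" "R \<in> tripod p U"
    and d: "dist P Q = 1" "dist Q R = 1" "dist P R = sqrt 3"
  shows "Q = p"
proof -
  obtain u e where P: "P = p + u *\<^sub>R e" "0 \<le> u" "e \<in> U" using PQR tripodE by metis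
  obtain w f where Q: "Q = p + w *\<^sub>R f" "0 \<le> w" "f \<in> U" using PQR tripodE by metis
  obtain v g where R: "R = p + v *\<^sub>R g" "0 \<le> v" "g \<in> U" using PQR tripodE by metis
  have PQ: "(if e = f then (u - w)\<^sup>2 else u\<^sup>2 + u * w + w\<^sup>2) = 1"
    and QR: "(if f = g then (w - v)\<^sup>2 else w\<^sup>2 + w * v + v\<^sup>2) = 1"
    and PR: "(if e = g then (u - v)\<^sup>2 else u\<^sup>2 + u * v + v\<^sup>2) = 3"
    using tripod_dist_sq [OF U P(3) Q(3), of p u w] tripod_dist_sq [OF U Q(3) R(3), of p w v]
      tripod_dist_sq [OF U P(3) R(3), of p u v] d
    by (simp_all add: P(1) Q(1) R(1))
  \<comment> \<open>The case of \<open>Q\<close> on the ray of one of its neighbours, at height \<open>n\<close>, and the other one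
    on a different ray, at height \<open>m\<close>.\<close>
  have shared: "w = 0"
    if "0 \<le> m" "0 \<le> n" "m\<^sup>2 + m * w + w\<^sup>2 = 1" "(w - n)\<^sup>2 = 1" "m\<^sup>2 + m * n + n\<^sup>2 = 3" for m n
  proof -
    have "w - n = 1 \<or> w - n = - 1" using that by (simp add: power2_eq_1_iff)
    then show "w = 0"
    proof
      assume "w - n = 1"
      then have n: "w = n + 1" by simp
      have "m + 2 * n = - 3"
        using that(3,5) unfolding n by (simp add: power2_eq_square algebra_simps)
      then show "w = 0" using that by linarith
    next
      assume "w - n = - 1"
      then have n: "n = w + 1" by simp
      have m: "m = 1 - 2 * w"
        using that(3,5) unfolding n by (simp add: power2_eq_square algebra_simps)
      have "w * (w - 1) = 0"
        using that(3) unfolding m by (simp add: power2_eq_square algebra_simps)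
      then show "w = 0" using m that by auto
    qed
  qed
  have "w = 0"
  proof -
    consider "e = f" "f = g" | "e = f" "f \<noteq> g" | "e \<noteq> f" "f = g" | "e \<noteq> f" "e = g"
      | "e \<noteq> f" "f \<noteq> g" "e \<noteq> g" by blast
    then show ?thesis
    proof cases
      case 1
      then have "u - w = 1 \<or> u - w = - 1" "w - v = 1 \<or> w - v = - 1" "(u - v)\<^sup>2 = 3"
        using PQ QR PR by (simp_all add: power2_eq_1_iff)
      then have "u - v \<in> {- 2, 0, 2}" by auto
      then show ?thesis using \<open>(u - v)\<^sup>2 = 3\<close> by auto
    next
      case 2
      then show ?thesis
        using shared [of v u] PQ QR PR P R by (simp add: power2_commute algebra_simps)
    next
      case 3
      then show ?thesis
        using shared [of u v] PQ QR PR P R by simp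
    next
      case 4
      then have *: "u\<^sup>2 + u * w + w\<^sup>2 = 1" "w\<^sup>2 + w * v + v\<^sup>2 = 1" "(u - v)\<^sup>2 = 3"
        using PQ QR PR by auto
      then have "(u - v) * (u + v + w) = 0"
        by (simp add: power2_eq_square algebra_simps)
      moreover have "u \<noteq> v" using * by auto
      ultimately have "u + v + w = 0" by simp
      then show ?thesis using P Q R by linarith
    next
      case 5
      then have *: "u\<^sup>2 + u * w + w\<^sup>2 = 1" "w\<^sup>2 + w * v + v\<^sup>2 = 1" "u\<^sup>2 + u * v + v\<^sup>2 = 3"
        using PQ QR PR by auto
      then have "(u - v) * (u + v + w) = 0"
        by (simp add: power2_eq_square algebra_simps)
      moreover have "u + v + w \<noteq> 0"
      proof
        assume "u + v + w = 0"
        then have "u = 0" "v = 0" using P Q R by linarith+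
        then show False using * by simp
      qed
      ultimately have "v = u" by auto
      then have "u\<^sup>2 = 1" using * by (simp add: power2_eq_square)
      then have "u = 1" using P by (simp add: power2_eq_1_iff)
      then have "w * (w + 1) = 0" using * by (simp add: power2_eq_square algebra_simps)
      then show ?thesis using Q by auto
    qed
  qed
  then show ?thesis using Q by simp
qed

section \<open>Minimality\<close>

text \<open>
  The set \<open>{P, Q, R}\<close> is itself a space with at most three points. Below, the triangles that force
  a point are found in the tripod, which saves constructing metrics on abstract sets.
\<close>

lemma universal_subset_contains_triangle:
  fixes S X :: "'a::metric_space set" and P Q R :: 'a
  assumes "universal_for (F3 :: 'a metric set) (submetric (submetric euclidean_metric X) S)"
    and "S \<subseteq> X"
  shows "\<exists>A\<in>S. \<exists>B\<in>S. \<exists>C\<in>S. dist A B = dist P Q \<and> dist B C = dist Q R \<and> dist A C = dist P R"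
proof -
  have "card {P, Q, R} \<le> 3"
    by (simp add: card_insert_if)
  then have "submetric euclidean_metric {P, Q, R} \<in> F3"
    by (simp add: F3_def)
  then obtain h where "isometric_embedding (submetric euclidean_metric {P, Q, R})
      (submetric (submetric euclidean_metric X) S) h"
    using assms(1) unfolding universal_for_def embeds_def by blast
  then show ?thesis
    by (auto simp: isometric_embedding_def Pi_iff)
qed

lemma universal_subset_of_tripod:
  fixes S :: "'a::real_inner set"
  assumes U: "tripod_frame U" and S: "S \<subseteq> tripod p U"
    and univ: "universal_for (F3 :: 'a metric set)
                 (submetric (submetric euclidean_metric (tripod p U)) S)"
  shows "S = tripod p U"
proof
  obtain e f g where efg: "U = {e, f, g}" "e \<noteq> f" "f \<noteq> g" "e \<noteq> g"
    using tripod_frame_obtain [OF U] by blast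
  note triangle = universal_subset_contains_triangle [OF univ S]
  have d: "dist (p + r *\<^sub>R i) (p + r *\<^sub>R j) = sqrt 3 * r"
    if "0 \<le> r" "i \<in> U" "j \<in> U" "i \<noteq> j" for r i j
    using that by (intro tripod_dist_eqI [OF U]) (auto simp: power_mult_distrib power2_eq_square)
  show "tripod p U \<subseteq> S"
  proof
    fix x
    assume "x \<in> tripod p U"
    then obtain r i where x: "x = p + r *\<^sub>R i" "0 \<le> r" "i \<in> U" by (rule tripodE)
    show "x \<in> S"
    proof (cases "r = 0")
      case True
      have "norm i = 1" if "i \<in> U" for i
        using U that by (simp add: tripod_frame_def norm_eq_1)
      then have "dist (p + e) p = 1" "dist p (p + f) = 1" "dist (p + e) (p + f) = sqrt 3"
        using efg d [of 1 e f] by (simp_all add: dist_norm)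
      then obtain A B C where "A \<in> S" "B \<in> S" "C \<in> S"
        "dist A B = 1" "dist B C = 1" "dist A C = sqrt 3"
        using triangle [of "p + e" p "p + f"] by auto
      then have "B = p" using tripod_apex_at_centre [OF U, of A p B C] S by blast
      then show ?thesis using True x \<open>B \<in> S\<close> by simp
    next
      case False
      then have r: "0 < r" using x by simp
      obtain A B C where ABC: "A \<in> S" "B \<in> S" "C \<in> S"
        "dist A B = sqrt 3 * r" "dist B C = sqrt 3 * r" "dist A C = sqrt 3 * r"
        using triangle [of "p + r *\<^sub>R e" "p + r *\<^sub>R f" "p + r *\<^sub>R g"] x efg d by auto
      then have "(\<lambda>i. p + r *\<^sub>R i) ` U = {A, B, C}"
        using tripod_equilateral_rigid [OF U _ _ _ r, of A p B C] S by blast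
      then show ?thesis using x ABC by auto
    qed
  qed
qed (fact S)

lemma tripod_minimal_universal:
  fixes p :: "'a::real_inner"
  assumes three: "\<exists>x y z :: 'z. distinct [x, y, z]" and U: "tripod_frame U"
  shows "minimal_universal_for (F3 :: 'z metric set) (submetric euclidean_metric (tripod p U))"
  unfolding minimal_universal_for_def
proof (intro conjI allI impI)
  show "universal_for (F3 :: 'z metric set) (submetric euclidean_metric (tripod p U))"
    by (rule tripod_universal [OF U])
next
  fix S
  assume S: "S \<subseteq> mspace (submetric euclidean_metric (tripod p U))"
    and univ: "universal_for (F3 :: 'z metric set)
      (submetric (submetric euclidean_metric (tripod p U)) S)"
  \<comment> \<open>The triangles that force the points of \<open>S\<close> have their vertices in the type of \<open>p\<close>, so the
    universality of \<open>S\<close> has to be carried over from \<open>'z\<close> to this type.\<close>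
  have "S = tripod p U"
    using universal_subset_of_tripod [OF U _ universal_for_F3_transfer [OF three univ]] S by simp
  then show "submetric (submetric euclidean_metric (tripod p U)) S
      = submetric euclidean_metric (tripod p U)"
    by (simp add: submetric_submetric)
qed

section \<open>The three rays\<close>

lemma ray_eq_unit_ray:
  fixes a p :: "'a::real_normed_vector"
  assumes "a \<noteq> p"
  shows "ray p a = {p + t *\<^sub>R sgn (a - p) | t. 0 \<le> t}"
proof -
  have n: "0 < norm (a - p)" using assms by simp
  show ?thesis
  proof
    show "ray p a \<subseteq> {p + t *\<^sub>R sgn (a - p) | t. 0 \<le> t}"
    proof
      fix x
      assume "x \<in> ray p a"
      then obtain t where "0 \<le> t" "x = p + t *\<^sub>R (a - p)" by (auto simp: ray_def)
      then have "x = p + (t * norm (a - p)) *\<^sub>R sgn (a - p) \<and> 0 \<le> t * norm (a - p)"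
        using n by (simp add: sgn_div_norm)
      then show "x \<in> {p + t *\<^sub>R sgn (a - p) | t. 0 \<le> t}" by blast
    qed
  next
    show "{p + t *\<^sub>R sgn (a - p) | t. 0 \<le> t} \<subseteq> ray p a"
    proof
      fix x
      assume "x \<in> {p + t *\<^sub>R sgn (a - p) | t. 0 \<le> t}"
      then obtain t where "0 \<le> t" "x = p + t *\<^sub>R sgn (a - p)" by auto
      then have "x = p + (t / norm (a - p)) *\<^sub>R (a - p) \<and> 0 \<le> t / norm (a - p)"
        by (simp add: sgn_div_norm divide_inverse)
      then show "x \<in> ray p a" unfolding ray_def by blast
    qed
  qed
qed

lemma angle_two_thirds_pi:
  fixes a b p :: "'a::real_inner"
  assumes "angle a p b = 2 * pi / 3"
  shows "sgn (a - p) \<bullet> sgn (b - p) = - 1 / 2"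
proof -
  let ?c = "((a - p) \<bullet> (b - p)) / (norm (a - p) * norm (b - p))"
  have "\<bar>?c\<bar> \<le> 1"
    using Cauchy_Schwarz_ineq2 [of "a - p" "b - p"]
    by (auto simp: divide_le_eq_1 abs_mult)
  then have "cos (angle a p b) = ?c"
    unfolding angle_def by (intro cos_arccos_abs)
  then have "?c = cos (2 * pi / 3)" using assms by simp
  also have "\<dots> = - 1 / 2" by (simp add: cos_120)
  finally have "?c = - 1 / 2" .
  moreover have "sgn u \<bullet> sgn v = (u \<bullet> v) / (norm u * norm v)" for u v :: 'a
    by (simp add: sgn_div_norm divide_inverse)
  ultimately show ?thesis by simp
qed

theorem theorem8p2:
  fixes p a b c :: "real^2" and X :: "(real^2) set"
  assumes "\<exists>x y z :: 'z. distinct [x, y, z]"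
    and "a \<noteq> p" and "b \<noteq> p" and "c \<noteq> p"
    and "angle a p b = 2 * pi / 3"
    and "angle b p c = 2 * pi / 3"
    and "angle c p a = 2 * pi / 3"
    and "X = ray p a \<union> ray p b \<union> ray p c"
  shows "minimal_universal_for (F3 :: 'z metric set) (submetric euclidean_metric X)"
proof -
  define e f g where "e = sgn (a - p)" and "f = sgn (b - p)" and "g = sgn (c - p)"
  have unit: "e \<bullet> e = 1" "f \<bullet> f = 1" "g \<bullet> g = 1"
    using assms(2-4) by (simp_all add: e_def f_def g_def norm_sgn flip: norm_eq_1)
  have inner: "e \<bullet> f = - 1 / 2" "f \<bullet> g = - 1 / 2" "g \<bullet> e = - 1 / 2"
    using assms(5-7) unfolding e_def f_def g_def by (blast intro: angle_two_thirds_pi)+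
  then have "e \<noteq> f" "f \<noteq> g" "g \<noteq> e" using unit by auto
  then have "tripod_frame {e, f, g}"
    using unit inner by (auto simp: tripod_frame_def inner_commute)
  moreover have "X = tripod p {e, f, g}"
    using assms(8) unfolding ray_eq_unit_ray [OF assms(2)] ray_eq_unit_ray [OF assms(3)]
      ray_eq_unit_ray [OF assms(4)] e_def [symmetric] f_def [symmetric] g_def [symmetric]
    by (auto simp: tripod_def)
  ultimately show ?thesis
    using tripod_minimal_universal [OF assms(1)] by simp
qed

end
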